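(* Let $(H_l,H_r,S)$ be a Hopf $*$-algebroid, with underlying $*$-algebra $H$, base $*$-algebras $A_l$, $A_r$, and left and right counits $\varepsilon_l$, $\varepsilon_r$. Then the counits and antipode satisfy, for all $h\in H$, $$\varepsilon_r(S^{-1}(h^* ))=(\varepsilon_r(h))^*,\qquad \varepsilon_l(S^{-1}(h^* ))=(\varepsilon_l(h))^*,\qquad S\big((S(h^* ))^*\big)=h,$$ and $A_l$ becomes an $H$-module $*$-algebra with respect to the $H$-action $h\cdot a=\varepsilon_l(hs_l(a))$, i.e. this action satisfies $$(h\cdot a)^*=S(h)^*\cdot a^*\qquad(h\in H,\ a\in A_l).$$
   Context: All algebras are unital associative $\mathbb{C}$-algebras. An $(s,t)$-ring over $A$ is an algebra $H$ with algebra homomorphisms $s:A\to H$, $t:A^{op}\to H$ whose images commute. Left bialgebroid over $A_l$: an $(s_l,t_l)$-ring $H$ over $A_l$ with $(A_l,A_l)$-bimodule structure $a_1\cdot h\cdot a_2=s_l(a_1)t_l(a_2)h$ and bimodule maps $\Delta_l:H\to H\otimes_{A_l}H$, $\Delta_l(h)=h_{(1)}\otimes h_{(2)}$, $\varepsilon_l:H\to A_l$, coassociative and counital, such that (i) $\Delta_l$ takes values in $\{\sum_ih_i\otimes h_i'\mid\sum_ih_it_l(a)\otimes h_i'=\sum_ih_i\otimes h_i's_l(a)\ \forall a\in A_l\}$ and is a unital algebra homomorphism into this algebra (factorwise multiplication); (ii) $\varepsilon_l(hh')=\varepsilon_l(hs_l(\varepsilon_l(h')))=\varepsilon_l(ht_l(\varepsilon_l(h')))$.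 Right bialgebroid over $A_r$: an $(s_r,t_r)$-ring $H$ over $A_r$ with bimodule structure $a_1\cdot h\cdot a_2=ht_r(a_1)s_r(a_2)$ and coassociative, counital bimodule maps $\Delta_r:H\to H\otimes_{A_r}H$, $\varepsilon_r:H\to A_r$, such that (i) $\Delta_r$ takes values in $\{\sum_ih_i\otimes h_i'\mid\sum_is_r(a)h_i\otimes h_i'=\sum_ih_i\otimes t_r(a)h_i'\ \forall a\in A_r\}$ and is a unital algebra homomorphism into this algebra; (ii) $\varepsilon_r(hh')=\varepsilon_r(s_r(\varepsilon_r(h))h')=\varepsilon_r(t_r(\varepsilon_r(h))h')$. A Hopf algebroid $(H_l,H_r,S)$ is a left $A_l$-bialgebroid $H_l$ and a right $A_r$-bialgebroid $H_r$ on the same algebra $H$ with an invertible $\mathbb{C}$-linear $S:H\to H$ such that: (i) $s_l\varepsilon_lt_r=t_r$, $t_l\varepsilon_ls_r=s_r$, $s_r\varepsilon_rt_l=t_l$, $t_r\varepsilon_rs_l=s_l$; (ii) $(\Delta_l\otimes\mathrm{id})\Delta_r=(\mathrm{id}\otimes\Delta_r)\Delta_l$ and $(\Delta_r\otimes\mathrm{id})\Delta_l=(\mathrm{id}\otimes\Delta_l)\Delta_r$; (iii) $S(t_l(a_1)ht_r(a_2))=s_r(a_2)S(h)s_l(a_1)$; (iv) $\mu_H(S\otimes\mathrm{id})\Delta_l=s_r\varepsilon_r$ and $\mu_H(\mathrm{id}\otimes S)\Delta_r=s_l\varepsilon_l$. A Hopf $*$-algebroid is a Hopf algebroid such that $H,A_l,A_r$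 are $*$-algebras (conjugate-linear anti-multiplicative involutions), $s_l$ and $s_r$ are $*$-preserving, $\varepsilon_lt_r(a^* )=(\varepsilon_ls_r(a))^*$ for $a\in A_r$, $\varepsilon_rt_l(a^* )=(\varepsilon_rs_l(a))^*$ for $a\in A_l$, and $\Delta_r(h^* )=(h_{(1)})^*\otimes(h_{(2)})^*$ for $h\in H$ (the map $*\otimes*:H\otimes_{A_l}H\to H\otimes_{A_r}H$ is well defined under the preceding conditions). *)

theory Defs
  imports
    Complex_Main
    "HOL-Library.Poly_Mapping"
    "HOL-Computational_Algebra.Group_Closure"
begin

section \<open>Complex algebras and complex *-algebras\<close>

text \<open>
  The classes are based on \<^class>\<open>ring\<close> and \<^class>\<open>monoid_mult\<close> rather than \<^class>\<open>ring_1\<close>,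
  which would exclude the zero algebra.
\<close>

class complex_algebra = ring + monoid_mult +
  fixes scaleC :: "complex \<Rightarrow> 'a \<Rightarrow> 'a"  (infixr "*\<^sub>C" 75)
  assumes scaleC_add_right: "c *\<^sub>C (x + y) = c *\<^sub>C x + c *\<^sub>C y"
    and scaleC_add_left: "(c + d) *\<^sub>C x = c *\<^sub>C x + d *\<^sub>C x"
    and scaleC_scaleC: "c *\<^sub>C d *\<^sub>C x = (c * d) *\<^sub>C x"
    and scaleC_one: "1 *\<^sub>C x = x"
    and mult_scaleC_left: "(c *\<^sub>C x) * y = c *\<^sub>C (x * y)"
    and mult_scaleC_right: "x * (c *\<^sub>C y) = c *\<^sub>C (x * y)"

class complex_star_algebra = complex_algebra +
  fixes star :: "'a \<Rightarrow> 'a"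
  assumes star_star: "star (star x) = x"
    and star_add: "star (x + y) = star x + star y"
    and star_scaleC: "star (c *\<^sub>C x) = cnj c *\<^sub>C star x"
    and star_mult: "star (x * y) = star y * star x"

definition clinear :: "('a::complex_algebra \<Rightarrow> 'b::complex_algebra) \<Rightarrow> bool" where
  "clinear f \<longleftrightarrow> (\<forall>x y. f (x + y) = f x + f y) \<and> (\<forall>c x. f (c *\<^sub>C x) = c *\<^sub>C f x)"

definition algebra_hom :: "('a::complex_algebra \<Rightarrow> 'b::complex_algebra) \<Rightarrow> bool" where
  "algebra_hom f \<longleftrightarrow> clinear f \<and> f 1 = 1 \<and> (\<forall>x y. f (x * y) = f x * f y)"

text \<open>Algebra homomorphisms from the opposite algebra of the domain.\<close>

definition algebra_op_hom :: "('a::complex_algebra \<Rightarrow> 'b::complex_algebra) \<Rightarrow> bool" where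
  "algebra_op_hom f \<longleftrightarrow> clinear f \<and> f 1 = 1 \<and> (\<forall>x y. f (x * y) = f y * f x)"


section \<open>Balanced tensor products\<close>

text \<open>
  \<open>H \<otimes>\<^sub>A H\<close> is the free abelian group on \<open>H \<times> H\<close> modulo the subgroup
  generated by biadditivity and by \<open>(x \<cdot> a) \<otimes> y = x \<otimes> (a \<cdot> y)\<close>, where
  \<open>ra x a = x \<cdot> a\<close> and \<open>la a y = a \<cdot> y\<close>.  Its elements are represented as the cosets, that
  is, as sets of formal sums.  Compatibility with complex scalars needs no extra relations, since
  scalars act through the unital algebra \<open>A\<close>.
\<close>

type_synonym 'h tensor2 = "('h \<times> 'h \<Rightarrow>\<^sub>0 int) set"
type_synonym 'h tensor3 = "('h \<times> 'h \<times> 'h \<Rightarrow>\<^sub>0 int) set"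

definition tensor_rels :: "('h::ab_group_add \<Rightarrow> 'a \<Rightarrow> 'h) \<Rightarrow> ('a \<Rightarrow> 'h \<Rightarrow> 'h) \<Rightarrow> 'h tensor2" where
  "tensor_rels ra la =
     {frag_of (x + x', y) - frag_of (x, y) - frag_of (x', y) | x x' y. True}
   \<union> {frag_of (x, y + y') - frag_of (x, y) - frag_of (x, y') | x y y'. True}
   \<union> {frag_of (ra x a, y) - frag_of (x, la a y) | x y a. True}"

definition tensor_class ::
  "('h::ab_group_add \<Rightarrow> 'a \<Rightarrow> 'h) \<Rightarrow> ('a \<Rightarrow> 'h \<Rightarrow> 'h) \<Rightarrow> ('h \<times> 'h \<Rightarrow>\<^sub>0 int) \<Rightarrow> 'h tensor2" where
  "tensor_class ra la X = {Y. Y - X \<in> group_closure (tensor_rels ra la)}"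

text \<open>
  The threefold product, with possibly different base algebras: \<open>ra\<close>, \<open>la\<close> balance the first two
  factors and \<open>ra'\<close>, \<open>la'\<close> the last two.
\<close>

definition tensor3_rels ::
  "('h::ab_group_add \<Rightarrow> 'a \<Rightarrow> 'h) \<Rightarrow> ('a \<Rightarrow> 'h \<Rightarrow> 'h) \<Rightarrow> ('h \<Rightarrow> 'b \<Rightarrow> 'h) \<Rightarrow> ('b \<Rightarrow> 'h \<Rightarrow> 'h)
     \<Rightarrow> 'h tensor3" where
  "tensor3_rels ra la ra' la' =
     {frag_of (x + x', y, z) - frag_of (x, y, z) - frag_of (x', y, z) | x x' y z. True}
   \<union> {frag_of (x, y + y', z) - frag_of (x, y, z) - frag_of (x, y', z) | x y y' z. True}
   \<union> {frag_of (x, y, z + z') - frag_of (x, y, z) - frag_of (x, y, z') | x y z z'. True}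
   \<union> {frag_of (ra x a, y, z) - frag_of (x, la a y, z) | x y z a. True}
   \<union> {frag_of (x, ra' y b, z) - frag_of (x, y, la' b z) | x y z b. True}"

definition tensor3_class ::
  "('h::ab_group_add \<Rightarrow> 'a \<Rightarrow> 'h) \<Rightarrow> ('a \<Rightarrow> 'h \<Rightarrow> 'h) \<Rightarrow> ('h \<Rightarrow> 'b \<Rightarrow> 'h) \<Rightarrow> ('b \<Rightarrow> 'h \<Rightarrow> 'h)
     \<Rightarrow> ('h \<times> 'h \<times> 'h \<Rightarrow>\<^sub>0 int) \<Rightarrow> 'h tensor3" where
  "tensor3_class ra la ra' la' X = {Y. Y - X \<in> group_closure (tensor3_rels ra la ra' la')}"

text \<open>
  Maps on tensor products are described on formal sums and applied to a chosen representative
  \<open>rep C\<close> of a coset.  Wherever this is used below, the map descends to the quotient by the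
  conditions imposed, so that the choice is immaterial.
\<close>

definition rep :: "'x set \<Rightarrow> 'x" where
  "rep C = (SOME X. X \<in> C)"

text \<open>\<open>f \<otimes> g\<close> on formal sums:\<close>

definition tmap :: "('h \<Rightarrow> 'h) \<Rightarrow> ('h \<Rightarrow> 'h) \<Rightarrow> ('h \<times> 'h \<Rightarrow>\<^sub>0 int) \<Rightarrow> ('h \<times> 'h \<Rightarrow>\<^sub>0 int)" where
  "tmap f g = frag_extend (\<lambda>(x, y). frag_of (f x, g y))"

text \<open>Factorwise multiplication of formal sums:\<close>

definition tmult ::
  "('h::times \<times> 'h \<Rightarrow>\<^sub>0 int) \<Rightarrow> ('h \<times> 'h \<Rightarrow>\<^sub>0 int) \<Rightarrow> ('h \<times> 'h \<Rightarrow>\<^sub>0 int)" where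
  "tmult X Y =
     frag_extend (\<lambda>(x, y). frag_extend (\<lambda>(x', y'). frag_of (x * x', y * y')) Y) X"

text \<open>The additive map sending \<open>(x, y)\<close> to \<open>f x y\<close>:\<close>

definition teval ::
  "('h \<Rightarrow> 'h \<Rightarrow> 'b::complex_algebra) \<Rightarrow> ('h \<times> 'h \<Rightarrow>\<^sub>0 int) \<Rightarrow> 'b" where
  "teval f X =
     (\<Sum>(x, y)\<in>Poly_Mapping.keys X. of_int (Poly_Mapping.lookup X (x, y)) *\<^sub>C f x y)"

text \<open>\<open>\<Delta> \<otimes> id\<close> and \<open>id \<otimes> \<Delta>\<close> on formal sums:\<close>

definition comult_fst ::
  "('h \<Rightarrow> 'h tensor2) \<Rightarrow> ('h \<times> 'h \<Rightarrow>\<^sub>0 int) \<Rightarrow> ('h \<times> 'h \<times> 'h \<Rightarrow>\<^sub>0 int)" where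
  "comult_fst \<Delta> =
     frag_extend (\<lambda>(x, y). frag_extend (\<lambda>(u, v). frag_of (u, v, y)) (rep (\<Delta> x)))"

definition comult_snd ::
  "('h \<Rightarrow> 'h tensor2) \<Rightarrow> ('h \<times> 'h \<Rightarrow>\<^sub>0 int) \<Rightarrow> ('h \<times> 'h \<times> 'h \<Rightarrow>\<^sub>0 int)" where
  "comult_snd \<Delta> =
     frag_extend (\<lambda>(x, y). frag_extend (\<lambda>(u, v). frag_of (x, u, v)) (rep (\<Delta> y)))"


section \<open>Bialgebroids\<close>

locale st_ring =
  fixes s t :: "'a::complex_algebra \<Rightarrow> 'h::complex_algebra"
  assumes s_hom: "algebra_hom s"
    and t_hom: "algebra_op_hom t"
    and s_t_commute: "s a * t b = t b * s a"

text \<open>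
  The bimodule structures: \<open>a \<cdot> h \<cdot> b = s a * t b * h\<close> for left bialgebroids and
  \<open>a \<cdot> h \<cdot> b = h * t a * s b\<close> for right bialgebroids.
\<close>

abbreviation l_lact :: "('a \<Rightarrow> 'h::times) \<Rightarrow> 'a \<Rightarrow> 'h \<Rightarrow> 'h" where
  "l_lact s \<equiv> (\<lambda>a h. s a * h)"

abbreviation l_ract :: "('a \<Rightarrow> 'h::times) \<Rightarrow> 'h \<Rightarrow> 'a \<Rightarrow> 'h" where
  "l_ract t \<equiv> (\<lambda>h a. t a * h)"

abbreviation r_lact :: "('a \<Rightarrow> 'h::times) \<Rightarrow> 'a \<Rightarrow> 'h \<Rightarrow> 'h" where
  "r_lact t \<equiv> (\<lambda>a h. h * t a)"

abbreviation r_ract :: "('a \<Rightarrow> 'h::times) \<Rightarrow> 'h \<Rightarrow> 'a \<Rightarrow> 'h" where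
  "r_ract s \<equiv> (\<lambda>h a. h * s a)"

definition l_class ::
  "('a \<Rightarrow> 'h::complex_algebra) \<Rightarrow> ('a \<Rightarrow> 'h) \<Rightarrow> ('h \<times> 'h \<Rightarrow>\<^sub>0 int) \<Rightarrow> 'h tensor2" where
  "l_class s t = tensor_class (l_ract t) (l_lact s)"

definition r_class ::
  "('a \<Rightarrow> 'h::complex_algebra) \<Rightarrow> ('a \<Rightarrow> 'h) \<Rightarrow> ('h \<times> 'h \<Rightarrow>\<^sub>0 int) \<Rightarrow> 'h tensor2" where
  "r_class s t = tensor_class (r_ract s) (r_lact t)"

locale left_bialgebroid = st_ring s t
  for s t :: "'a::complex_algebra \<Rightarrow> 'h::complex_algebra" +
  fixes \<Delta> :: "'h \<Rightarrow> 'h tensor2" and \<epsilon> :: "'h \<Rightarrow> 'a"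
  assumes \<Delta>_range: "\<Delta> h \<in> range (l_class s t)"
    and \<Delta>_add: "\<Delta> (h + h') = l_class s t (rep (\<Delta> h) + rep (\<Delta> h'))"
    and \<Delta>_bimod:
      "\<Delta> (s a * t b * h) = l_class s t (tmap (\<lambda>x. s a * x) (\<lambda>y. t b * y) (rep (\<Delta> h)))"
    and \<epsilon>_add: "\<epsilon> (h + h') = \<epsilon> h + \<epsilon> h'"
    and \<epsilon>_bimod: "\<epsilon> (s a * t b * h) = a * \<epsilon> h * b"
    and coassoc:
      "tensor3_class (l_ract t) (l_lact s) (l_ract t) (l_lact s) (comult_fst \<Delta> (rep (\<Delta> h)))
     = tensor3_class (l_ract t) (l_lact s) (l_ract t) (l_lact s) (comult_snd \<Delta> (rep (\<Delta> h)))"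
    and counit_left: "teval (\<lambda>x y. s (\<epsilon> x) * y) (rep (\<Delta> h)) = h"
    and counit_right: "teval (\<lambda>x y. t (\<epsilon> y) * x) (rep (\<Delta> h)) = h"
    and takeuchi:
      "l_class s t (tmap (\<lambda>x. x * t a) id (rep (\<Delta> h)))
     = l_class s t (tmap id (\<lambda>y. y * s a) (rep (\<Delta> h)))"
    and \<Delta>_one: "\<Delta> 1 = l_class s t (frag_of (1, 1))"
    and \<Delta>_mult: "\<Delta> (h * h') = l_class s t (tmult (rep (\<Delta> h)) (rep (\<Delta> h')))"
    and \<epsilon>_mult_s: "\<epsilon> (h * h') = \<epsilon> (h * s (\<epsilon> h'))"
    and \<epsilon>_mult_t: "\<epsilon> (h * h') = \<epsilon> (h * t (\<epsilon> h'))"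

locale right_bialgebroid = st_ring s t
  for s t :: "'a::complex_algebra \<Rightarrow> 'h::complex_algebra" +
  fixes \<Delta> :: "'h \<Rightarrow> 'h tensor2" and \<epsilon> :: "'h \<Rightarrow> 'a"
  assumes \<Delta>_range: "\<Delta> h \<in> range (r_class s t)"
    and \<Delta>_add: "\<Delta> (h + h') = r_class s t (rep (\<Delta> h) + rep (\<Delta> h'))"
    and \<Delta>_bimod:
      "\<Delta> (h * t a * s b) = r_class s t (tmap (\<lambda>x. x * t a) (\<lambda>y. y * s b) (rep (\<Delta> h)))"
    and \<epsilon>_add: "\<epsilon> (h + h') = \<epsilon> h + \<epsilon> h'"
    and \<epsilon>_bimod: "\<epsilon> (h * t a * s b) = a * \<epsilon> h * b"
    and coassoc:
      "tensor3_class (r_ract s) (r_lact t) (r_ract s) (r_lact t) (comult_fst \<Delta> (rep (\<Delta> h)))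
     = tensor3_class (r_ract s) (r_lact t) (r_ract s) (r_lact t) (comult_snd \<Delta> (rep (\<Delta> h)))"
    and counit_left: "teval (\<lambda>x y. y * t (\<epsilon> x)) (rep (\<Delta> h)) = h"
    and counit_right: "teval (\<lambda>x y. x * s (\<epsilon> y)) (rep (\<Delta> h)) = h"
    and takeuchi:
      "r_class s t (tmap (\<lambda>x. s a * x) id (rep (\<Delta> h)))
     = r_class s t (tmap id (\<lambda>y. t a * y) (rep (\<Delta> h)))"
    and \<Delta>_one: "\<Delta> 1 = r_class s t (frag_of (1, 1))"
    and \<Delta>_mult: "\<Delta> (h * h') = r_class s t (tmult (rep (\<Delta> h)) (rep (\<Delta> h')))"
    and \<epsilon>_mult_s: "\<epsilon> (h * h') = \<epsilon> (s (\<epsilon> h) * h')"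
    and \<epsilon>_mult_t: "\<epsilon> (h * h') = \<epsilon> (t (\<epsilon> h) * h')"


section \<open>Hopf algebroids and Hopf *-algebroids\<close>

locale hopf_algebroid =
  left: left_bialgebroid sl tl \<Delta>l \<epsilon>l + right: right_bialgebroid sr tr \<Delta>r \<epsilon>r
  for sl tl :: "'al::complex_algebra \<Rightarrow> 'h::complex_algebra"
    and \<Delta>l :: "'h \<Rightarrow> 'h tensor2" and \<epsilon>l :: "'h \<Rightarrow> 'al"
    and sr tr :: "'ar::complex_algebra \<Rightarrow> 'h"
    and \<Delta>r :: "'h \<Rightarrow> 'h tensor2" and \<epsilon>r :: "'h \<Rightarrow> 'ar" +
  fixes S :: "'h \<Rightarrow> 'h"
  assumes S_bij: "bij S"
    and S_clinear: "clinear S"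
    and sl_\<epsilon>l_tr: "sl (\<epsilon>l (tr a)) = tr a"
    and tl_\<epsilon>l_sr: "tl (\<epsilon>l (sr a)) = sr a"
    and sr_\<epsilon>r_tl: "sr (\<epsilon>r (tl b)) = tl b"
    and tr_\<epsilon>r_sl: "tr (\<epsilon>r (sl b)) = sl b"
    and coassoc_lr:
      "tensor3_class (l_ract tl) (l_lact sl) (r_ract sr) (r_lact tr) (comult_fst \<Delta>l (rep (\<Delta>r h)))
     = tensor3_class (l_ract tl) (l_lact sl) (r_ract sr) (r_lact tr) (comult_snd \<Delta>r (rep (\<Delta>l h)))"
    and coassoc_rl:
      "tensor3_class (r_ract sr) (r_lact tr) (l_ract tl) (l_lact sl) (comult_fst \<Delta>r (rep (\<Delta>l h)))
     = tensor3_class (r_ract sr) (r_lact tr) (l_ract tl) (l_lact sl) (comult_snd \<Delta>l (rep (\<Delta>r h)))"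
    and S_twist: "S (tl b * h * tr a) = sr a * S h * sl b"
    and antipode_left: "teval (\<lambda>x y. S x * y) (rep (\<Delta>l h)) = sr (\<epsilon>r h)"
    and antipode_right: "teval (\<lambda>x y. x * S y) (rep (\<Delta>r h)) = sl (\<epsilon>l h)"

locale hopf_star_algebroid =
  hopf_algebroid sl tl \<Delta>l \<epsilon>l sr tr \<Delta>r \<epsilon>r S
  for sl tl :: "'al::complex_star_algebra \<Rightarrow> 'h::complex_star_algebra"
    and \<Delta>l :: "'h \<Rightarrow> 'h tensor2" and \<epsilon>l :: "'h \<Rightarrow> 'al"
    and sr tr :: "'ar::complex_star_algebra \<Rightarrow> 'h"
    and \<Delta>r :: "'h \<Rightarrow> 'h tensor2" and \<epsilon>r :: "'h \<Rightarrow> 'ar"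
    and S :: "'h \<Rightarrow> 'h" +
  assumes sl_star: "sl (star b) = star (sl b)"
    and sr_star: "sr (star a) = star (sr a)"
    and \<epsilon>l_tr_star: "\<epsilon>l (tr (star a)) = star (\<epsilon>l (sr a))"
    and \<epsilon>r_tl_star: "\<epsilon>r (tl (star b)) = star (\<epsilon>r (sl b))"
    and \<Delta>r_star: "\<Delta>r (star h) = r_class sr tr (tmap star star (rep (\<Delta>l h)))"

text \<open>The action \<open>h \<cdot> a\<close> of \<open>H\<close> on the base algebra of a left bialgebroid:\<close>

definition base_action ::
  "('a \<Rightarrow> 'h::times) \<Rightarrow> ('h \<Rightarrow> 'a) \<Rightarrow> 'h \<Rightarrow> 'a \<Rightarrow> 'a" where
  "base_action s \<epsilon> h a = \<epsilon> (h * s a)"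

end

theory Submission
  imports Defs
begin

text \<open>
  In Sweedler notation, \<open>\<Delta>l h = h\<^sub>1 \<otimes> h\<^sub>2\<close> and \<open>\<Delta>r h = h\<^sup>1 \<otimes> h\<^sup>2\<close>.  The involution
  exchanges the two coproducts, so it should exchange the structure attached to the one with the
  structure attached to the other.  Everything follows from two uniqueness principles.

  Counits.  Since \<open>\<Delta>r (h\<^sup>*) = h\<^sub>1\<^sup>* \<otimes> h\<^sub>2\<^sup>*\<close>, the map \<open>g \<mapsto> \<epsilon>r (sl (\<epsilon>l (g\<^sup>*)\<^sup>*))\<close> is a counit for
  \<open>\<Delta>r\<close>, and counits are unique (\<open>counit_unique\<close>); hence \<open>\<epsilon>r (h\<^sup>*) = \<epsilon>r (sl (\<epsilon>l h)\<^sup>*)\<close>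
  (\<open>\<epsilon>r_star\<close>).  On the other hand the antipode laws give \<open>\<epsilon>r \<circ> S\<^sup>-\<^sup>1 = \<epsilon>r \<circ> tl \<circ> \<epsilon>l\<close> and
  \<open>\<epsilon>l \<circ> S\<^sup>-\<^sup>1 = \<epsilon>l \<circ> tr \<circ> \<epsilon>r\<close> (\<open>\<epsilon>r_inv_S\<close>, \<open>\<epsilon>l_inv_S\<close>), and the two facts together yield the formulas for
  \<open>\<epsilon>r (S\<^sup>-\<^sup>1 (h\<^sup>*))\<close> and \<open>\<epsilon>l (S\<^sup>-\<^sup>1 (h\<^sup>*))\<close>.

  Antipode.  A map with the properties of \<open>S\<close> that concern \<open>\<Delta>l\<close> equals \<open>S\<close>: collapse
  \<open>T(x) y S(z)\<close>, evaluated on the two sides of the mixed coassociativity law, from either end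
  (\<open>antipode_unique\<close>).  The map \<open>T h = (S\<^sup>-\<^sup>1 (h\<^sup>*))\<^sup>*\<close> has these properties, because
  \<open>T(h\<^sub>1) h\<^sub>2\<close> is the adjoint of \<open>g\<^sup>2 S\<^sup>-\<^sup>1(g\<^sup>1) = S\<^sup>-\<^sup>1 (g\<^sup>1 S(g\<^sup>2))\<close> with \<open>g = h\<^sup>*\<close>.  So \<open>T = S\<close>, which is
  the identity \<open>S ((S (h\<^sup>*))\<^sup>*) = h\<close>.  This uses that \<open>S\<close> is anti-multiplicative (\<open>S_mult\<close>), which is not
  an axiom; its proof again collapses one expression from two ends.  The statement on the action of \<open>H\<close> on the base
  algebra is then the formula for \<open>\<epsilon>l (S\<^sup>-\<^sup>1 (h\<^sup>*))\<close> applied to \<open>h sl(a)\<close>.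

  An identity in Sweedler notation is an identity between values of a map on representatives
  of a coproduct.  It is legitimate to replace the representative as soon as the map is balanced, and
  the side conditions in the calculations below check precisely this.
\<close>

section \<open>Evaluating formal sums\<close>

definition frag_eval :: "('x \<Rightarrow> 'b::complex_algebra) \<Rightarrow> ('x \<Rightarrow>\<^sub>0 int) \<Rightarrow> 'b" where
  "frag_eval f X = (\<Sum>p\<in>Poly_Mapping.keys X. of_int (Poly_Mapping.lookup X p) *\<^sub>C f p)"

lemma teval_eq_frag_eval: "teval f = frag_eval (\<lambda>(x, y). f x y)"
  by (simp add: fun_eq_iff teval_def frag_eval_def case_prod_unfold)

lemma frag_eval_frag_of [simp]: "frag_eval f (frag_of p) = f p"
  by (simp add: frag_eval_def scaleC_one)

lemma additive_frag_eval: "additive (frag_eval f)"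
proof
  have zero_left: "0 *\<^sub>C y = 0" for y :: 'b
    using scaleC_add_left[of 0 0 y] by simp
  show "frag_eval f (X + Y) = frag_eval f X + frag_eval f Y" for X Y
    unfolding frag_eval_def
    by (rule setsum_keys_plus_distrib) (simp_all add: zero_left scaleC_add_left)
qed

lemmas frag_eval_add = additive.add[OF additive_frag_eval]
  and frag_eval_diff = additive.diff[OF additive_frag_eval]
  and frag_eval_zero = additive.zero[OF additive_frag_eval]

text \<open>
  Formal sums are generated by the \<open>frag_of p\<close>, so an additive map is its values on them.  The identities
  that follow compare two additive maps of \<open>X\<close> in this way.
\<close>

lemma additive_eq_frag_eval:
  fixes F :: "('x \<Rightarrow>\<^sub>0 int) \<Rightarrow> 'b::complex_algebra"
  assumes "additive F"
  shows "F X = frag_eval (\<lambda>p. F (frag_of p)) X"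
  using subset_UNIV
proof (induction X rule: frag_induction)
  case zero
  then show ?case by (simp add: additive.zero[OF assms] frag_eval_zero)
next
  case (one x)
  then show ?case by simp
next
  case (diff a b)
  then show ?case by (simp add: additive.diff[OF assms] frag_eval_diff)
qed

lemma frag_eval_frag_extend:
  "frag_eval f (frag_extend g X) = frag_eval (\<lambda>p. frag_eval f (g p)) X"
proof -
  have "additive (\<lambda>X. frag_eval f (frag_extend g X))"
    by standard (simp add: frag_extend_add frag_eval_add)
  from additive_eq_frag_eval[OF this, of X] show ?thesis
    by simp
qed

lemma additive_frag_eval_commute:
  fixes \<phi> :: "'b::complex_algebra \<Rightarrow> 'c::complex_algebra"
  assumes "additive \<phi>"
  shows "\<phi> (frag_eval f X) = frag_eval (\<lambda>p. \<phi> (f p)) X"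
proof -
  interpret additive \<phi> by (rule assms)
  have "additive (\<lambda>X. \<phi> (frag_eval f X))"
    by standard (simp add: add frag_eval_add)
  from additive_eq_frag_eval[OF this, of X] show ?thesis
    by simp
qed

lemma frag_eval_add_fun: "frag_eval (\<lambda>p. f p + g p) X = frag_eval f X + frag_eval g X"
  by (simp add: frag_eval_def scaleC_add_right sum.distrib)

lemma frag_eval_swap:
  "frag_eval (\<lambda>p. frag_eval (\<lambda>q. f p q) Y) X = frag_eval (\<lambda>q. frag_eval (\<lambda>p. f p q) X) Y"
proof -
  have "additive (\<lambda>X. frag_eval (\<lambda>q. frag_eval (\<lambda>p. f p q) X) Y)"
    by standard (simp add: frag_eval_add frag_eval_add_fun)
  from additive_eq_frag_eval[OF this, of X] show ?thesis
    by simp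
qed

section \<open>Balanced maps and Sweedler sums\<close>

text \<open>
  In Sweedler notation this is \<open>f h\<^sub>1 h\<^sub>2\<close>, and nested sums express iterated coproducts.  For \<open>f\<close>
  that is not balanced the value may depend on the chosen representative.
\<close>

definition sweedler ::
  "('h \<Rightarrow> 'h tensor2) \<Rightarrow> ('h \<Rightarrow> 'h \<Rightarrow> 'b::complex_algebra) \<Rightarrow> 'h \<Rightarrow> 'b" where
  "sweedler \<Delta> f h = teval f (rep (\<Delta> h))"

definition balanced ::
  "('h::ab_group_add \<Rightarrow> 'a \<Rightarrow> 'h) \<Rightarrow> ('a \<Rightarrow> 'h \<Rightarrow> 'h) \<Rightarrow> ('h \<Rightarrow> 'h \<Rightarrow> 'b::complex_algebra) \<Rightarrow> bool" where
  "balanced ra la f \<longleftrightarrow>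
     (\<forall>x x' y. f (x + x') y = f x y + f x' y) \<and>
     (\<forall>x y y'. f x (y + y') = f x y + f x y') \<and>
     (\<forall>x y a. f (ra x a) y = f x (la a y))"

text \<open>
  Maps that descend to the threefold tensor product.  Additivity in the middle argument is shared by the
  two conjuncts.
\<close>

definition balanced3 ::
  "('h::ab_group_add \<Rightarrow> 'a \<Rightarrow> 'h) \<Rightarrow> ('a \<Rightarrow> 'h \<Rightarrow> 'h) \<Rightarrow> ('h \<Rightarrow> 'c \<Rightarrow> 'h) \<Rightarrow> ('c \<Rightarrow> 'h \<Rightarrow> 'h)
     \<Rightarrow> ('h \<Rightarrow> 'h \<Rightarrow> 'h \<Rightarrow> 'b::complex_algebra) \<Rightarrow> bool" where
  "balanced3 ra la ra' la' f \<longleftrightarrow>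
     (\<forall>z. balanced ra la (\<lambda>x y. f x y z)) \<and>
     (\<forall>x. balanced ra' la' (f x))"

lemma frag_eval_eq_if_diff_in_closure:
  assumes "X - Y \<in> group_closure R" and "\<And>r. r \<in> R \<Longrightarrow> frag_eval f r = 0"
  shows "frag_eval f X = frag_eval f Y"
proof -
  have "frag_eval f Z = 0" if "Z \<in> group_closure R" for Z
    using that by induction (auto simp: assms(2) frag_eval_zero frag_eval_diff)
  from this[OF assms(1)] show ?thesis
    by (simp add: frag_eval_diff)
qed

lemma teval_eq_if_same_class:
  assumes "balanced ra la f" and "X \<in> tensor_class ra la Y"
  shows "teval f X = teval f Y"
proof -
  have "frag_eval (\<lambda>(x, y). f x y) r = 0" if "r \<in> tensor_rels ra la" for r
    using that assms(1) by (auto simp: tensor_rels_def balanced_def frag_eval_diff)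
  then show ?thesis
    using frag_eval_eq_if_diff_in_closure[of X Y "tensor_rels ra la" "\<lambda>(x, y). f x y"] assms(2)
    by (auto simp: teval_eq_frag_eval tensor_class_def)
qed

lemma self_in_tensor_class: "X \<in> tensor_class ra la X"
  by (simp add: tensor_class_def)

lemma teval_eq_if_class_eq:
  assumes "balanced ra la f" and "tensor_class ra la X = tensor_class ra la Y"
  shows "teval f X = teval f Y"
  using teval_eq_if_same_class[OF assms(1), of X Y] assms(2) self_in_tensor_class[of X ra la] by simp

text \<open>
  Every formula for \<open>\<Delta> h\<close> turns into a computation rule for balanced maps, whatever
  representative of \<open>\<Delta> h\<close> is used.
\<close>

lemma sweedler_eq_teval:
  assumes "balanced ra la f" and "\<Delta> h = tensor_class ra la Y"
  shows "sweedler \<Delta> f h = teval f Y"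
  unfolding sweedler_def
proof (rule teval_eq_if_same_class[OF assms(1)])
  show "rep (\<Delta> h) \<in> tensor_class ra la Y"
    unfolding assms(2) rep_def by (rule someI) (rule self_in_tensor_class)
qed

lemma frag_eval_eq_if_class3_eq:
  assumes "balanced3 ra la ra' la' f"
    and "tensor3_class ra la ra' la' X = tensor3_class ra la ra' la' Y"
  shows "frag_eval (\<lambda>(x, y, z). f x y z) X = frag_eval (\<lambda>(x, y, z). f x y z) Y"
proof (rule frag_eval_eq_if_diff_in_closure)
  show "X - Y \<in> group_closure (tensor3_rels ra la ra' la')"
  proof -
    have "X \<in> tensor3_class ra la ra' la' X"
      by (simp add: tensor3_class_def)
    then show ?thesis
      unfolding assms(2) by (simp add: tensor3_class_def)
  qed
  show "frag_eval (\<lambda>(x, y, z). f x y z) r = 0" if "r \<in> tensor3_rels ra la ra' la'" for r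
    using that assms(1)
    by (auto simp: tensor3_rels_def balanced3_def balanced_def frag_eval_diff)
qed

lemma teval_frag_of [simp]: "teval f (frag_of (x, y)) = f x y"
  by (simp add: teval_eq_frag_eval)

lemma teval_tmap: "teval f (tmap g k X) = teval (\<lambda>x y. f (g x) (k y)) X"
  by (simp add: teval_eq_frag_eval tmap_def frag_eval_frag_extend case_prod_unfold)

lemma teval_tmult:
  "teval f (tmult X Y) = teval (\<lambda>x y. teval (\<lambda>x' y'. f (x * x') (y * y')) Y) X"
  by (simp add: teval_eq_frag_eval tmult_def frag_eval_frag_extend case_prod_unfold)

lemma frag_eval_comult_fst:
  "frag_eval (\<lambda>(x, y, z). f x y z) (comult_fst \<Delta> (rep (\<Delta>' h)))
   = sweedler \<Delta>' (\<lambda>p z. sweedler \<Delta> (\<lambda>x y. f x y z) p) h"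
  by (simp add: teval_eq_frag_eval sweedler_def comult_fst_def frag_eval_frag_extend case_prod_unfold)

lemma frag_eval_comult_snd:
  "frag_eval (\<lambda>(x, y, z). f x y z) (comult_snd \<Delta> (rep (\<Delta>' h)))
   = sweedler \<Delta>' (\<lambda>x q. sweedler \<Delta> (\<lambda>y z. f x y z) q) h"
  by (simp add: teval_eq_frag_eval sweedler_def comult_snd_def frag_eval_frag_extend case_prod_unfold)

lemma additive_sweedler:
  fixes \<phi> :: "'b::complex_algebra \<Rightarrow> 'c::complex_algebra"
  assumes "additive \<phi>"
  shows "\<phi> (sweedler \<Delta> f h) = sweedler \<Delta> (\<lambda>x y. \<phi> (f x y)) h"
  by (simp add: sweedler_def teval_eq_frag_eval additive_frag_eval_commute[OF assms] case_prod_unfold)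

lemma sweedler_add_fun:
  "sweedler \<Delta> (\<lambda>x y. f x y + g x y) h = sweedler \<Delta> f h + sweedler \<Delta> g h"
  by (simp add: sweedler_def teval_eq_frag_eval frag_eval_add_fun case_prod_unfold)

lemma sweedler_mult_left: "a * sweedler \<Delta> f h = sweedler \<Delta> (\<lambda>x y. a * f x y) h"
  by (rule additive_sweedler) (standard, simp add: distrib_left)

lemma sweedler_mult_right: "sweedler \<Delta> f h * a = sweedler \<Delta> (\<lambda>x y. f x y * a) h"
  by (rule additive_sweedler) (standard, simp add: distrib_right)

lemma sweedler_swap:
  "sweedler \<Delta> (\<lambda>x y. sweedler \<Delta>' (\<lambda>u v. f x y u v) k) h
   = sweedler \<Delta>' (\<lambda>u v. sweedler \<Delta> (\<lambda>x y. f x y u v) h) k"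
  using frag_eval_swap[of "\<lambda>p q. f (fst p) (snd p) (fst q) (snd q)" "rep (\<Delta>' k)" "rep (\<Delta> h)"]
  by (simp add: sweedler_def teval_eq_frag_eval case_prod_unfold)

section \<open>Bialgebroids\<close>

context st_ring
begin

lemma s_one: "s 1 = 1" and s_mult: "s (a * b) = s a * s b" and s_add: "s (a + b) = s a + s b"
  using s_hom by (simp_all add: algebra_hom_def clinear_def)

lemma t_one: "t 1 = 1" and t_mult: "t (a * b) = t b * t a" and t_add: "t (a + b) = t a + t b"
  using t_hom by (simp_all add: algebra_op_hom_def clinear_def)

end

context left_bialgebroid
begin

lemma sweedler_one:
  assumes "balanced (l_ract t) (l_lact s) f"
  shows "sweedler \<Delta> f 1 = f 1 1"
  using sweedler_eq_teval[where \<Delta> = \<Delta>, OF assms \<Delta>_one[unfolded l_class_def]] by simp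

lemma sweedler_mult:
  assumes "balanced (l_ract t) (l_lact s) f"
  shows "sweedler \<Delta> f (h * h')
    = sweedler \<Delta> (\<lambda>x y. sweedler \<Delta> (\<lambda>x' y'. f (x * x') (y * y')) h') h"
  using sweedler_eq_teval[where \<Delta> = \<Delta>, OF assms \<Delta>_mult[unfolded l_class_def]]
  by (simp add: teval_tmult sweedler_def)

text \<open>
  The Takeuchi condition moves a factor between the legs on the right, where the balancing of the
  tensor product acts on the left.
\<close>

lemma sweedler_takeuchi:
  assumes "balanced (l_ract t) (l_lact s) f"
  shows "sweedler \<Delta> (\<lambda>x y. f (x * t a) y) h = sweedler \<Delta> (\<lambda>x y. f x (y * s a)) h"
  using teval_eq_if_class_eq[OF assms takeuchi[unfolded l_class_def]]
  by (simp add: teval_tmap sweedler_def)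

lemma sweedler_counit_left: "sweedler \<Delta> (\<lambda>x y. s (\<epsilon> x) * y) h = h"
  and sweedler_counit_right: "sweedler \<Delta> (\<lambda>x y. t (\<epsilon> y) * x) h = h"
  by (simp_all add: sweedler_def counit_left counit_right)

lemma \<epsilon>_s_mult: "\<epsilon> (s a * h) = a * \<epsilon> h"
  using \<epsilon>_bimod[of a 1 h] by (simp add: t_one)

lemma \<epsilon>_t_mult: "\<epsilon> (t a * h) = \<epsilon> h * a"
  using \<epsilon>_bimod[of 1 a h] by (simp add: s_one)

text \<open>
  The base algebra may fail to embed into \<open>H\<close> (take \<open>H = 0\<close>), so \<open>\<epsilon> 1 = 1\<close> cannot be expected.  The
  element \<open>\<epsilon> 1\<close> is nevertheless sent to \<open>1\<close> by \<open>s\<close> and \<open>t\<close> and acts as a unit on the values of \<open>\<epsilon>\<close>,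
  which is all that the calculations require.
\<close>

lemma s_\<epsilon>_one: "s (\<epsilon> 1) = 1"
  using sweedler_counit_left[of 1] sweedler_one[of "\<lambda>x y. s (\<epsilon> x) * y"]
  by (simp add: balanced_def \<epsilon>_add s_add distrib_left distrib_right \<epsilon>_t_mult s_mult mult.assoc)

lemma t_\<epsilon>_one: "t (\<epsilon> 1) = 1"
  using sweedler_counit_right[of 1] sweedler_one[of "\<lambda>x y. t (\<epsilon> y) * x"]
  by (simp add: balanced_def \<epsilon>_add t_add distrib_left distrib_right \<epsilon>_s_mult t_mult mult.assoc)

lemma \<epsilon>_one_mult: "\<epsilon> 1 * \<epsilon> h = \<epsilon> h"
  using \<epsilon>_s_mult[of "\<epsilon> 1" h] by (simp add: s_\<epsilon>_one)

lemma \<epsilon>_mult_base: "\<epsilon> (h * t a) = \<epsilon> (h * s a)"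
proof -
  have "\<epsilon> (h * s a) = \<epsilon> (h * t (\<epsilon> (s a)))"
    by (rule \<epsilon>_mult_t)
  also have "\<epsilon> (s a) = a * \<epsilon> 1"
    using \<epsilon>_s_mult[of a 1] by simp
  finally show ?thesis
    by (simp add: t_mult t_\<epsilon>_one)
qed

end

context right_bialgebroid
begin

lemma sweedler_one:
  assumes "balanced (r_ract s) (r_lact t) f"
  shows "sweedler \<Delta> f 1 = f 1 1"
  using sweedler_eq_teval[where \<Delta> = \<Delta>, OF assms \<Delta>_one[unfolded r_class_def]] by simp

lemma sweedler_mult_t:
  assumes "balanced (r_ract s) (r_lact t) f"
  shows "sweedler \<Delta> f (h * t a) = sweedler \<Delta> (\<lambda>x y. f (x * t a) y) h"
  using sweedler_eq_teval[where \<Delta> = \<Delta>, OF assms \<Delta>_bimod[of h a 1, unfolded r_class_def]]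
  by (simp add: teval_tmap sweedler_def s_one)

lemma sweedler_takeuchi:
  assumes "balanced (r_ract s) (r_lact t) f"
  shows "sweedler \<Delta> (\<lambda>x y. f (s a * x) y) h = sweedler \<Delta> (\<lambda>x y. f x (t a * y)) h"
  using teval_eq_if_class_eq[OF assms takeuchi[unfolded r_class_def]]
  by (simp add: teval_tmap sweedler_def)

lemma sweedler_counit_left: "sweedler \<Delta> (\<lambda>x y. y * t (\<epsilon> x)) h = h"
  and sweedler_counit_right: "sweedler \<Delta> (\<lambda>x y. x * s (\<epsilon> y)) h = h"
  by (simp_all add: sweedler_def counit_left counit_right)

lemma \<epsilon>_mult_t_right: "\<epsilon> (h * t a) = a * \<epsilon> h"
  using \<epsilon>_bimod[of h a 1] by (simp add: s_one)

lemma \<epsilon>_mult_s_right: "\<epsilon> (h * s a) = \<epsilon> h * a"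
  using \<epsilon>_bimod[of h 1 a] by (simp add: t_one)

lemma s_\<epsilon>_one: "s (\<epsilon> 1) = 1"
  using sweedler_counit_right[of 1] sweedler_one[of "\<lambda>x y. x * s (\<epsilon> y)"]
  by (simp add: balanced_def \<epsilon>_add s_add distrib_left distrib_right \<epsilon>_mult_t_right s_mult mult.assoc)

text \<open>
  A left unit and a right unit coincide, in coalgebra form: evaluate \<open>\<epsilon> h\<^sup>1 \<cdot> \<epsilon>' h\<^sup>2\<close> by the counit law of
  \<open>\<epsilon>'\<close> and by that of \<open>\<epsilon>\<close>.
\<close>

lemma counit_unique:
  assumes add: "\<And>x y. \<epsilon>' (x + y) = \<epsilon>' x + \<epsilon>' y"
    and linear: "\<And>h a. \<epsilon>' (h * t a) = a * \<epsilon>' h"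
    and counit: "sweedler \<Delta> (\<lambda>x y. x * s (\<epsilon>' y)) h = h"
  shows "\<epsilon> h = \<epsilon>' h"
proof -
  have "\<epsilon> h = \<epsilon> (sweedler \<Delta> (\<lambda>x y. x * s (\<epsilon>' y)) h)"
    by (simp add: counit)
  also have "\<dots> = sweedler \<Delta> (\<lambda>x y. \<epsilon> (x * s (\<epsilon>' y))) h"
    by (rule additive_sweedler) (simp add: additive_def \<epsilon>_add)
  also have "\<dots> = sweedler \<Delta> (\<lambda>x y. \<epsilon>' (y * t (\<epsilon> x))) h"
    by (simp add: \<epsilon>_mult_s_right linear)
  also have "\<dots> = \<epsilon>' (sweedler \<Delta> (\<lambda>x y. y * t (\<epsilon> x)) h)"
    by (rule additive_sweedler[symmetric]) (simp add: additive_def add)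
  finally show ?thesis
    by (simp add: sweedler_counit_left)
qed

end

section \<open>The antipode\<close>

context hopf_algebroid
begin

lemma mixed_coassoc:
  assumes "balanced3 (l_ract tl) (l_lact sl) (r_ract sr) (r_lact tr) f"
  shows "sweedler \<Delta>r (\<lambda>p z. sweedler \<Delta>l (\<lambda>x y. f x y z) p) h
       = sweedler \<Delta>l (\<lambda>x q. sweedler \<Delta>r (\<lambda>y z. f x y z) q) h"
  using frag_eval_eq_if_class3_eq[OF assms coassoc_lr[of h]]
  by (simp only: frag_eval_comult_fst frag_eval_comult_snd)

text \<open>
  The bimodule properties of \<open>S\<close> are kept in the two forms that make \<open>S x * y\<close> balanced for \<open>\<Delta>l\<close> and
  \<open>x * S y\<close> balanced for \<open>\<Delta>r\<close>.
\<close>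

lemma S_add: "S (x + y) = S x + S y"
  using S_clinear by (simp add: clinear_def)

lemma S_tl_mult: "S (tl b * h) = S h * sl b"
  using S_twist[of b h 1] by (simp add: right.t_one right.s_one)

lemma S_mult_tr: "S (h * tr a) = sr a * S h"
  using S_twist[of 1 h a] by (simp add: left.t_one left.s_one)

lemmas S_simps = S_add S_tl_mult S_mult_tr distrib_left distrib_right mult.assoc

lemma sweedler_antipode_left: "sweedler \<Delta>l (\<lambda>x y. S x * y) h = sr (\<epsilon>r h)"
  and sweedler_antipode_right: "sweedler \<Delta>r (\<lambda>x y. x * S y) h = sl (\<epsilon>l h)"
  by (simp_all add: sweedler_def antipode_left antipode_right)

text \<open>
  The image of \<open>sr\<close> is contained in that of \<open>tl\<close>, which commutes with that of \<open>sl\<close>.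
\<close>

lemma sl_sr_commute: "sl a * sr b = sr b * sl a"
  using left.s_t_commute[of a "\<epsilon>l (sr b)"] by (simp add: tl_\<epsilon>l_sr)

lemma S_one: "S 1 = 1"
proof -
  have "balanced (l_ract tl) (l_lact sl) (\<lambda>x y. S x * y)"
    by (simp add: balanced_def S_simps)
  from left.sweedler_one[OF this] show ?thesis
    by (simp add: sweedler_antipode_left right.s_\<epsilon>_one)
qed

lemma S_tl: "S (tl b) = sl b" and S_tr: "S (tr a) = sr a"
  using S_tl_mult[of b 1] S_mult_tr[of 1 a] by (simp_all add: S_one)

lemma S_eq_sweedler: "S h = sweedler \<Delta>l (\<lambda>x y. S x * sl (\<epsilon>l y)) h"
proof -
  have "S h = S (sweedler \<Delta>l (\<lambda>x y. tl (\<epsilon>l y) * x) h)"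
    by (simp add: left.sweedler_counit_right)
  also have "\<dots> = sweedler \<Delta>l (\<lambda>x y. S (tl (\<epsilon>l y) * x)) h"
    by (rule additive_sweedler) (simp add: additive_def S_add)
  finally show ?thesis
    by (simp add: S_tl_mult)
qed

lemma S_eq_sweedler_right: "sweedler \<Delta>r (\<lambda>x y. sr (\<epsilon>r x) * S y) h = S h"
proof -
  have "S h = S (sweedler \<Delta>r (\<lambda>x y. y * tr (\<epsilon>r x)) h)"
    by (simp add: right.sweedler_counit_left)
  also have "\<dots> = sweedler \<Delta>r (\<lambda>x y. S (y * tr (\<epsilon>r x))) h"
    by (rule additive_sweedler) (simp add: additive_def S_add)
  finally show ?thesis
    by (simp add: S_mult_tr)
qed

text \<open>
  The antipode as a convolution inverse: \<open>T(h\<^sub>1) h\<^sub>2\<^sup>1 S(h\<^sub>2\<^sup>2)\<close> equals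
  \<open>T(h\<^sup>1\<^sub>1) h\<^sup>1\<^sub>2 S(h\<^sup>2)\<close>.  The product with \<open>S\<close> collapses in the first expression and the one with \<open>T\<close>
  in the second; the remaining counits are absorbed by the twist properties of \<open>T\<close> and of \<open>S\<close>.
\<close>

lemma antipode_unique:
  assumes T_add: "\<And>x y. T (x + y) = T x + T y"
    and T_tl_mult: "\<And>b h. T (tl b * h) = T h * sl b"
    and T_antipode: "\<And>h. sweedler \<Delta>l (\<lambda>x y. T x * y) h = sr (\<epsilon>r h)"
  shows "T h = S h"
proof -
  have "T h = T (sweedler \<Delta>l (\<lambda>x y. tl (\<epsilon>l y) * x) h)"
    by (simp add: left.sweedler_counit_right)
  also have "\<dots> = sweedler \<Delta>l (\<lambda>x y. T (tl (\<epsilon>l y) * x)) h"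
    by (rule additive_sweedler) (simp add: additive_def T_add)
  also have "\<dots> = sweedler \<Delta>l (\<lambda>x q. sweedler \<Delta>r (\<lambda>y z. T x * (y * S z)) q) h"
    by (simp add: T_tl_mult sweedler_mult_left[symmetric] sweedler_antipode_right)
  also have "\<dots> = sweedler \<Delta>r (\<lambda>p z. sweedler \<Delta>l (\<lambda>x y. T x * (y * S z)) p) h"
    by (rule mixed_coassoc[symmetric])
      (simp add: balanced3_def balanced_def additive_def S_simps T_add T_tl_mult)
  also have "\<dots> = sweedler \<Delta>r (\<lambda>p z. sr (\<epsilon>r p) * S z) h"
    by (simp add: mult.assoc[symmetric] sweedler_mult_right[symmetric] T_antipode)
  finally show ?thesis
    by (simp add: S_eq_sweedler_right)
qed

text \<open>
  The twist property controls \<open>S\<close> on right multiples by \<open>tr a\<close>; left multiples need a coproduct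
  argument.  Insert \<open>sr a\<close> between \<open>S(h\<^sub>1)\<close> and \<open>h\<^sub>2\<^sup>1 S(h\<^sub>2\<^sup>2) = sl (\<epsilon>l h\<^sub>2)\<close>: it can leave to the
  right because \<open>sr a\<close> and \<open>sl b\<close> commute, or enter \<open>S\<close> as \<open>tr a\<close> by the Takeuchi condition for \<open>\<Delta>r\<close>.
\<close>

lemma S_tr_mult: "S (tr a * h) = S h * sr a"
proof -
  have "S h * sr a = sweedler \<Delta>l (\<lambda>x q. S x * sl (\<epsilon>l q) * sr a) h"
    by (subst S_eq_sweedler) (rule sweedler_mult_right)
  also have "\<dots> = sweedler \<Delta>l (\<lambda>x q. sweedler \<Delta>r (\<lambda>y z. S x * (sr a * (y * S z))) q) h"
    by (simp add: sl_sr_commute mult.assoc sweedler_mult_left[symmetric] sweedler_antipode_right)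
  also have "\<dots> = sweedler \<Delta>l (\<lambda>x q. sweedler \<Delta>r (\<lambda>y z. S x * (y * S (tr a * z))) q) h"
  proof -
    have "sweedler \<Delta>r (\<lambda>y z. S x * ((sr a * y) * S z)) q
        = sweedler \<Delta>r (\<lambda>y z. S x * (y * S (tr a * z))) q" for x q
      by (rule right.sweedler_takeuchi[where f = "\<lambda>y z. S x * (y * S z)"])
        (simp add: balanced_def S_simps)
    then show ?thesis
      by (simp add: mult.assoc)
  qed
  also have "\<dots> = sweedler \<Delta>r (\<lambda>p z. sweedler \<Delta>l (\<lambda>x y. S x * (y * S (tr a * z))) p) h"
    by (rule mixed_coassoc[symmetric])
      (simp add: balanced3_def balanced_def additive_def S_simps
        S_mult_tr[of "tr a * h" for h, unfolded mult.assoc])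
  also have "\<dots> = sweedler \<Delta>r (\<lambda>p z. sr (\<epsilon>r p) * S (tr a * z)) h"
    by (simp add: mult.assoc[symmetric] sweedler_mult_right[symmetric] sweedler_antipode_left)
  also have "\<dots> = sweedler \<Delta>r (\<lambda>p z. S (tr a * (z * tr (\<epsilon>r p)))) h"
    by (simp add: S_mult_tr[symmetric] mult.assoc)
  also have "\<dots> = S (tr a * sweedler \<Delta>r (\<lambda>p z. z * tr (\<epsilon>r p)) h)"
    by (rule additive_sweedler[symmetric]) (simp add: additive_def S_simps)
  finally show ?thesis
    by (simp add: right.sweedler_counit_left)
qed

text \<open>
  The classical argument that both sides are convolution inverse to multiplication: collapse
  \<open>S(h\<^sub>1 k\<^sub>1) h\<^sub>2\<^sup>1 k\<^sub>2\<^sup>1 S(k\<^sub>2\<^sup>2) S(h\<^sub>2\<^sup>2)\<close> from the right to \<open>S(h k)\<close> and, after reassociating both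
  coproducts, from the left to \<open>S(k) S(h)\<close>.  Over non-commutative bases this expression is not balanced
  in all variables at once, so the order matters.  The coproduct of \<open>h\<close> is reassociated first, while
  \<open>k\<^sub>2\<^sup>1 S(k\<^sub>2\<^sup>2)\<close> is still collapsed to \<open>sl (\<epsilon>l k\<^sub>2)\<close>, which commutes with \<open>sr\<close>.  The coproduct of
  \<open>k\<close> comes second, when the sum over \<open>\<Delta>l\<close> of the first leg of \<open>h\<close> is innermost and the Takeuchi
  condition makes the expression balanced in \<open>k\<close>.
\<close>

lemma S_mult: "S (h * k) = S k * S h"
proof -
  have inner: "sl (\<epsilon>l (h2 * k2)) = sweedler \<Delta>r (\<lambda>x y. x * sl (\<epsilon>l k2) * S y) h2" for h2 k2
  proof -
    \<comment> \<open>Rewritten as a value of \<open>tr\<close>, the factor can be pulled out of \<open>\<Delta>r\<close> on the right.\<close>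
    define a where "a = \<epsilon>r (sl (\<epsilon>l k2))"
    have a: "tr a = sl (\<epsilon>l k2)"
      by (simp add: a_def tr_\<epsilon>r_sl)
    have "sl (\<epsilon>l (h2 * k2)) = sl (\<epsilon>l (h2 * tr a))"
      unfolding a by (subst left.\<epsilon>_mult_s) (rule refl)
    also have "\<dots> = sweedler \<Delta>r (\<lambda>x y. x * S y) (h2 * tr a)"
      by (simp add: sweedler_antipode_right)
    also have "\<dots> = sweedler \<Delta>r (\<lambda>x y. x * tr a * S y) h2"
      by (rule right.sweedler_mult_t) (simp add: balanced_def S_simps)
    finally show ?thesis
      by (simp add: a)
  qed
  have "S (h * k) = sweedler \<Delta>l (\<lambda>x y. S x * sl (\<epsilon>l y)) (h * k)"
    by (rule S_eq_sweedler)
  also have "\<dots> = sweedler \<Delta>l (\<lambda>h1 h2. sweedler \<Delta>l (\<lambda>k1 k2. S (h1 * k1) * sl (\<epsilon>l (h2 * k2))) k) h"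
    by (rule left.sweedler_mult)
      (simp add: balanced_def S_simps left.\<epsilon>_add left.s_add left.\<epsilon>_s_mult left.s_mult)
  also have "\<dots> = sweedler \<Delta>l (\<lambda>k1 k2. sweedler \<Delta>l (\<lambda>h1 h2. sweedler \<Delta>r (\<lambda>x y.
      S (h1 * k1) * (x * (sl (\<epsilon>l k2) * S y))) h2) h) k"
    by (subst sweedler_swap) (simp add: inner sweedler_mult_left mult.assoc)
  also have "\<dots> = sweedler \<Delta>l (\<lambda>k1 k2. sweedler \<Delta>r (\<lambda>p y. sweedler \<Delta>l (\<lambda>h1 x.
      S (h1 * k1) * (x * (sl (\<epsilon>l k2) * S y))) p) h) k"
  proof -
    have "sl b * (sr a * z) = sr a * (sl b * z)" for a b z
      using sl_sr_commute[of b a] by (simp add: mult.assoc[symmetric])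
    then show ?thesis
      by (subst mixed_coassoc)
        (simp_all add: balanced3_def balanced_def additive_def S_simps)
  qed
  also have "\<dots> = sweedler \<Delta>r (\<lambda>p y. sweedler \<Delta>l (\<lambda>k1 k2. sweedler \<Delta>r (\<lambda>u v. 
      sweedler \<Delta>l (\<lambda>h1 x. S (h1 * k1) * (x * u)) p * (S v * S y)) k2) k) h"
  proof -
    have "sweedler \<Delta>l (\<lambda>h1 x. S (h1 * k1) * (x * (sl (\<epsilon>l k2) * S y))) p
      = sweedler \<Delta>r (\<lambda>u v. sweedler \<Delta>l (\<lambda>h1 x. S (h1 * k1) * (x * u)) p * (S v * S y)) k2"
      for k1 k2 p y
      unfolding sweedler_mult_right
      by (subst sweedler_swap)
        (simp add: sweedler_antipode_right[symmetric] sweedler_mult_left sweedler_mult_right mult.assoc)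
    then show ?thesis
      by (subst sweedler_swap) simp
  qed
  also have "\<dots> = sweedler \<Delta>r (\<lambda>p y. sweedler \<Delta>r (\<lambda>q v. sweedler \<Delta>l (\<lambda>k1 u.
      sweedler \<Delta>l (\<lambda>h1 x. S (h1 * k1) * (x * u)) p * (S v * S y)) q) k) h"
  proof -
    have "balanced3 (l_ract tl) (l_lact sl) (r_ract sr) (r_lact tr)
      (\<lambda>k1 u v. sweedler \<Delta>l (\<lambda>h1 x. S (h1 * k1) * (x * u)) p * (S v * S y))" for p y
    proof -
      have "sweedler \<Delta>l (\<lambda>h1 x. S (h1 * (tl a * k1)) * (x * u)) p
        = sweedler \<Delta>l (\<lambda>h1 x. S (h1 * k1) * (x * (sl a * u))) p" for a k1 u
        using left.sweedler_takeuchi[where f = "\<lambda>h1 x. S (h1 * k1) * (x * u)" and a = a and h = p]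
        by (simp add: balanced_def S_simps)
      moreover have "sweedler \<Delta>l (\<lambda>h1 x. S (h1 * k1) * (x * (u * sr a))) p
        = sweedler \<Delta>l (\<lambda>h1 x. S (h1 * k1) * (x * u)) p * sr a" for a k1 u
        by (simp add: sweedler_mult_right mult.assoc)
      ultimately show ?thesis
        by (simp add: balanced3_def balanced_def additive_def S_simps sweedler_add_fun)
    qed
    from mixed_coassoc[OF this] show ?thesis
      by simp
  qed
  also have "\<dots> = sweedler \<Delta>r (\<lambda>p y. sweedler \<Delta>r (\<lambda>q v. sr (\<epsilon>r (p * q)) * (S v * S y)) k) h"
  proof -
    have "sr (\<epsilon>r (p * q)) = sweedler \<Delta>l (\<lambda>k1 u. sweedler \<Delta>l (\<lambda>h1 x. S (h1 * k1) * (x * u)) p) q"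
      for p q
      unfolding sweedler_antipode_left[symmetric]
      by (subst left.sweedler_mult, simp add: balanced_def S_simps) (rule sweedler_swap)
    then show ?thesis
      by (simp add: sweedler_mult_right)
  qed
  also have "\<dots> = sweedler \<Delta>r (\<lambda>p y. S (tr (\<epsilon>r p) * k) * S y) h"
  proof -
    have "sweedler \<Delta>r (\<lambda>q v. sr (\<epsilon>r (p * q)) * S v) k = S (tr (\<epsilon>r p) * k)" for p
    proof -
      have "sweedler \<Delta>r (\<lambda>q v. sr (\<epsilon>r (p * q)) * S v) k
        = sweedler \<Delta>r (\<lambda>q v. sr (\<epsilon>r (sr (\<epsilon>r p) * q)) * S v) k"
        by (subst right.\<epsilon>_mult_s) (rule refl)
      also have "\<dots> = sweedler \<Delta>r (\<lambda>q v. sr (\<epsilon>r q) * S (tr (\<epsilon>r p) * v)) k"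
        by (rule right.sweedler_takeuchi[where f = "\<lambda>q v. sr (\<epsilon>r q) * S v"])
          (simp add: balanced_def S_simps right.\<epsilon>_add right.s_add right.\<epsilon>_mult_s_right right.s_mult)
      also have "\<dots> = sweedler \<Delta>r (\<lambda>q v. sr (\<epsilon>r q) * S v * sr (\<epsilon>r p)) k"
        by (simp add: S_tr_mult mult.assoc)
      also have "\<dots> = S k * sr (\<epsilon>r p)"
        by (simp add: sweedler_mult_right[symmetric] S_eq_sweedler_right)
      finally show ?thesis
        by (simp add: S_tr_mult)
    qed
    then show ?thesis
      by (simp add: mult.assoc[symmetric] sweedler_mult_right[symmetric])
  qed
  also have "\<dots> = S k * S h"
    by (simp add: S_tr_mult mult.assoc sweedler_mult_left[symmetric] S_eq_sweedler_right)
  finally show ?thesis .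
qed

end

section \<open>Counits and the inverse of the antipode\<close>

context hopf_algebroid
begin

text \<open>
  Apply \<open>\<epsilon>l\<close> to \<open>S(h\<^sub>1) h\<^sub>2 = sr (\<epsilon>r h)\<close> and absorb the right factor; \<open>\<epsilon>r_S\<close> is the mirror image.
\<close>

lemma \<epsilon>l_S: "\<epsilon>l (S h) = \<epsilon>l (sr (\<epsilon>r h))"
proof -
  have add: "additive \<epsilon>l"
    by (simp add: additive_def left.\<epsilon>_add)
  have "\<epsilon>l (sr (\<epsilon>r h)) = sweedler \<Delta>l (\<lambda>x y. \<epsilon>l (S x * y)) h"
    by (simp add: sweedler_antipode_left[symmetric] additive_sweedler[OF add])
  also have "\<dots> = sweedler \<Delta>l (\<lambda>x y. \<epsilon>l (S x * sl (\<epsilon>l y))) h"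
    by (subst left.\<epsilon>_mult_s) (rule refl)
  finally show ?thesis
    by (simp add: additive_sweedler[OF add, symmetric] S_eq_sweedler[symmetric])
qed

lemma \<epsilon>r_S: "\<epsilon>r (S h) = \<epsilon>r (sl (\<epsilon>l h))"
proof -
  have add: "additive \<epsilon>r"
    by (simp add: additive_def right.\<epsilon>_add)
  have "\<epsilon>r (sl (\<epsilon>l h)) = sweedler \<Delta>r (\<lambda>x y. \<epsilon>r (x * S y)) h"
    by (simp add: sweedler_antipode_right[symmetric] additive_sweedler[OF add])
  also have "\<dots> = sweedler \<Delta>r (\<lambda>x y. \<epsilon>r (sr (\<epsilon>r x) * S y)) h"
    by (subst right.\<epsilon>_mult_s) (rule refl)
  finally show ?thesis
    by (simp add: additive_sweedler[OF add, symmetric] S_eq_sweedler_right)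
qed

lemma S_inv: "S (inv S h) = h" and inv_S: "inv S (S h) = h"
  using S_bij by (simp_all add: bij_is_surj surj_f_inv_f bij_is_inj)

lemma S_eq_iff: "S x = S y \<longleftrightarrow> x = y"
  using S_bij by (auto simp: bij_def inj_def)

text \<open>
  The previous two lemmas can be solved for \<open>S\<^sup>-\<^sup>1\<close>, since \<open>\<epsilon>r \<circ> tl\<close> undoes \<open>\<epsilon>l \<circ> sr\<close> and \<open>\<epsilon>l \<circ> tr\<close> undoes
  \<open>\<epsilon>r \<circ> sl\<close> on values of the counits.
\<close>

lemma \<epsilon>r_inv_S: "\<epsilon>r (inv S h) = \<epsilon>r (tl (\<epsilon>l h))"
proof -
  have "\<epsilon>r (tl (\<epsilon>l (sr (\<epsilon>r z)))) = \<epsilon>r z" for z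
    using right.\<epsilon>_mult_s[of z 1] by (simp add: tl_\<epsilon>l_sr)
  then show ?thesis
    using \<epsilon>l_S[of "inv S h"] by (simp add: S_inv)
qed

lemma \<epsilon>l_inv_S: "\<epsilon>l (inv S h) = \<epsilon>l (tr (\<epsilon>r h))"
proof -
  have "\<epsilon>l (tr (\<epsilon>r (sl (\<epsilon>l z)))) = \<epsilon>l z" for z
    using left.\<epsilon>_mult_s[of 1 z] by (simp add: tr_\<epsilon>r_sl)
  then show ?thesis
    using \<epsilon>r_S[of "inv S h"] by (simp add: S_inv)
qed

lemma inv_S_add: "inv S (x + y) = inv S x + inv S y"
  by (subst S_eq_iff[symmetric]) (simp add: S_inv S_add)

lemma inv_S_mult: "inv S (x * y) = inv S y * inv S x"
  by (subst S_eq_iff[symmetric]) (simp add: S_inv S_mult)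

lemma inv_S_sl: "inv S (sl b) = tl b" and inv_S_sr: "inv S (sr a) = tr a"
  by (simp_all add: inv_S S_tl[symmetric] S_tr[symmetric])

end

section \<open>The involution\<close>

lemma star_one: "star (1::'a::complex_star_algebra) = 1"
  by (metis mult.right_neutral star_mult star_star mult_1)

context hopf_star_algebroid
begin

lemma \<epsilon>r_tl: "\<epsilon>r (tl b) = star (\<epsilon>r (sl (star b)))"
  using \<epsilon>r_tl_star[of "star b"] by (simp add: star_star)

lemma sweedler_star:
  assumes "balanced (r_ract sr) (r_lact tr) f"
  shows "sweedler \<Delta>r f (star h) = sweedler \<Delta>l (\<lambda>x y. f (star x) (star y)) h"
  using sweedler_eq_teval[where \<Delta> = \<Delta>r, OF assms \<Delta>r_star[unfolded r_class_def]]
  by (simp add: teval_tmap sweedler_def)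

text \<open>
  The involution takes \<open>tl\<close> to \<open>sr\<close> because \<open>tl\<close> has its values in the image of the *-preserving map \<open>sr\<close>.
\<close>

lemma star_tl: "star (tl b) = sr (\<epsilon>r (sl (star b)))"
proof -
  have "tl b = sr (star (\<epsilon>r (sl (star b))))"
    using sr_\<epsilon>r_tl[of b] by (simp add: \<epsilon>r_tl)
  then show ?thesis
    by (simp add: sr_star star_star)
qed

text \<open>
  The right-hand side, as a function of \<open>g = h\<^sup>*\<close>, is left linear and a right counit for \<open>\<Delta>r\<close>: under
  \<open>\<Delta>r_star\<close> its counit law is the adjoint of the counit law of \<open>\<epsilon>l\<close>.
\<close>

lemma \<epsilon>r_star: "\<epsilon>r (star h) = \<epsilon>r (sl (star (\<epsilon>l h)))"
proof -
  define \<epsilon>' where "\<epsilon>' g = \<epsilon>r (sl (star (\<epsilon>l (star g))))" for g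
  have add: "\<epsilon>' (x + y) = \<epsilon>' x + \<epsilon>' y" for x y
    by (simp add: \<epsilon>'_def star_add left.\<epsilon>_add left.s_add right.\<epsilon>_add)
  have linear: "\<epsilon>' (g * tr a) = a * \<epsilon>' g" for g a
  proof -
    have "star (tr a) = sl (star (\<epsilon>l (tr a)))"
      by (simp add: sl_star sl_\<epsilon>l_tr)
    then show ?thesis
      by (simp add: \<epsilon>'_def star_mult left.\<epsilon>_s_mult star_star left.s_mult sl_\<epsilon>l_tr right.\<epsilon>_mult_t_right)
  qed
  have "sweedler \<Delta>r (\<lambda>x y. x * sr (\<epsilon>' y)) (star h)
      = sweedler \<Delta>l (\<lambda>x y. star x * sr (\<epsilon>' (star y))) h"
    by (rule sweedler_star)
      (simp add: balanced_def distrib_left distrib_right add linear right.s_add right.s_mult mult.assoc)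
  also have "\<dots> = sweedler \<Delta>l (\<lambda>x y. star (tl (\<epsilon>l y) * x)) h"
    by (simp add: \<epsilon>'_def star_star star_mult star_tl)
  also have "\<dots> = star (sweedler \<Delta>l (\<lambda>x y. tl (\<epsilon>l y) * x) h)"
    by (rule additive_sweedler[symmetric]) (simp add: additive_def star_add)
  finally have "sweedler \<Delta>r (\<lambda>x y. x * sr (\<epsilon>' y)) (star h) = star h"
    by (simp add: left.sweedler_counit_right)
  from right.counit_unique[OF add linear this] show ?thesis
    by (simp add: \<epsilon>'_def star_star)
qed

lemma \<epsilon>r_inv_S_star: "\<epsilon>r (inv S (star h)) = star (\<epsilon>r h)"
proof -
  have "\<epsilon>r (inv S (star h)) = star (\<epsilon>r (sl (star (\<epsilon>l (star h)))))"
    by (simp add: \<epsilon>r_inv_S \<epsilon>r_tl)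
  also have "\<epsilon>r (sl (star (\<epsilon>l (star h)))) = \<epsilon>r h"
    using \<epsilon>r_star[of "star h"] by (simp add: star_star)
  finally show ?thesis .
qed

text \<open>
  Since \<open>\<epsilon>l 1\<close> need not be \<open>1\<close>, its self-adjointness requires an argument: with \<open>e = \<epsilon>l 1\<close>, the element \<open>sl (e\<^sup>*)\<close> is
  \<open>1\<close>, so \<open>e\<^sup>* e = e\<close>, and the left-hand side is self-adjoint.
\<close>

lemma star_\<epsilon>l_one: "star (\<epsilon>l 1) = \<epsilon>l 1"
proof -
  have "star (\<epsilon>l 1) * \<epsilon>l 1 = \<epsilon>l 1"
    using left.\<epsilon>_s_mult[of "star (\<epsilon>l 1)" 1] by (simp add: sl_star left.s_\<epsilon>_one star_one)
  moreover from arg_cong[OF this, of star] have "star (\<epsilon>l 1) * \<epsilon>l 1 = star (\<epsilon>l 1)"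
    by (simp add: star_mult star_star)
  ultimately show ?thesis
    by simp
qed

lemma \<epsilon>l_inv_S_star: "\<epsilon>l (inv S (star h)) = star (\<epsilon>l h)"
proof -
  have "\<epsilon>l (inv S (star h)) = \<epsilon>l (sl (star (\<epsilon>l h)))"
    by (simp add: \<epsilon>l_inv_S \<epsilon>r_star tr_\<epsilon>r_sl)
  also have "\<dots> = star (\<epsilon>l 1 * \<epsilon>l h)"
    using left.\<epsilon>_s_mult[of "star (\<epsilon>l h)" 1] by (simp add: star_mult star_\<epsilon>l_one)
  finally show ?thesis
    by (simp add: left.\<epsilon>_one_mult)
qed

text \<open>
  The conjugate of \<open>S\<^sup>-\<^sup>1\<close> satisfies the laws that characterise \<open>S\<close>.  The twist law uses that the
  involution takes \<open>tl\<close> to \<open>sr\<close> and \<open>S\<^sup>-\<^sup>1\<close> takes \<open>sr\<close> to \<open>tr\<close>.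
\<close>

lemma star_inv_S_star: "star (inv S (star h)) = S h"
proof (rule antipode_unique)
  show "star (inv S (star (x + y))) = star (inv S (star x)) + star (inv S (star y))" for x y
    by (simp add: star_add inv_S_add)
  show "star (inv S (star (tl b * x))) = star (inv S (star x)) * sl b" for b x
    by (simp add: star_mult star_tl inv_S_mult inv_S_sr tr_\<epsilon>r_sl star_star flip: sl_star)
  show "sweedler \<Delta>l (\<lambda>x y. star (inv S (star x)) * y) g = sr (\<epsilon>r g)" for g
  proof -
    have "sweedler \<Delta>l (\<lambda>x y. star (inv S (star x)) * y) g
        = star (sweedler \<Delta>l (\<lambda>x y. star y * inv S (star x)) g)"
      by (subst additive_sweedler) (simp_all add: additive_def star_add star_mult star_star)
    also have "sweedler \<Delta>l (\<lambda>x y. star y * inv S (star x)) g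
        = sweedler \<Delta>r (\<lambda>x y. y * inv S x) (star g)"
      by (rule sweedler_star[symmetric])
        (simp add: balanced_def distrib_left distrib_right inv_S_add inv_S_mult inv_S_sr mult.assoc)
    also have "\<dots> = sweedler \<Delta>r (\<lambda>x y. inv S (x * S y)) (star g)"
      by (simp add: inv_S_mult inv_S)
    also have "\<dots> = inv S (sweedler \<Delta>r (\<lambda>x y. x * S y) (star g))"
      by (rule additive_sweedler[symmetric]) (simp add: additive_def inv_S_add)
    also have "\<dots> = tl (\<epsilon>l (star g))"
      by (simp add: sweedler_antipode_right inv_S_sl)
    also have "star \<dots> = sr (\<epsilon>r g)"
      using \<epsilon>r_star[of "star g"] by (simp add: star_tl star_star)
    finally show ?thesis .
  qed
qed

lemma S_star_S_star: "S (star (S (star h))) = h"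
  using star_inv_S_star[of "star h", symmetric] by (simp add: star_star S_inv)

text \<open>
  By the formula for \<open>\<epsilon>l (S\<^sup>-\<^sup>1 (x\<^sup>*))\<close> with \<open>x = h sl(a)\<close>.  Applying \<open>S\<^sup>-\<^sup>1\<close> leaves \<open>tl (a\<^sup>*)\<close> on the right,
  and under \<open>\<epsilon>l\<close> this may be replaced by \<open>sl (a\<^sup>*)\<close>.
\<close>

lemma star_base_action:
  "star (base_action sl \<epsilon>l h a) = base_action sl \<epsilon>l (star (S h)) (star a)"
proof -
  have "star (\<epsilon>l (h * sl a)) = \<epsilon>l (inv S (star h) * inv S (sl (star a)))"
    by (simp add: \<epsilon>l_inv_S_star[symmetric] star_mult sl_star inv_S_mult)
  also have "\<dots> = \<epsilon>l (star (S h) * sl (star a))"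
    by (simp add: inv_S_sl left.\<epsilon>_mult_base star_inv_S_star[symmetric] star_star)
  finally show ?thesis
    by (simp add: base_action_def)
qed

end

theorem proposition3p2p3:
  fixes sl tl :: "'al::complex_star_algebra \<Rightarrow> 'h::complex_star_algebra"
    and \<Delta>l :: "'h \<Rightarrow> 'h tensor2" and \<epsilon>l :: "'h \<Rightarrow> 'al"
    and sr tr :: "'ar::complex_star_algebra \<Rightarrow> 'h"
    and \<Delta>r :: "'h \<Rightarrow> 'h tensor2" and \<epsilon>r :: "'h \<Rightarrow> 'ar"
    and S :: "'h \<Rightarrow> 'h"
  assumes "hopf_star_algebroid sl tl \<Delta>l \<epsilon>l sr tr \<Delta>r \<epsilon>r S"
  shows "(\<forall>h. \<epsilon>r (inv S (star h)) = star (\<epsilon>r h))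
       \<and> (\<forall>h. \<epsilon>l (inv S (star h)) = star (\<epsilon>l h))
       \<and> (\<forall>h. S (star (S (star h))) = h)
       \<and> (\<forall>h a. star (base_action sl \<epsilon>l h a) = base_action sl \<epsilon>l (star (S h)) (star a))"
  by (intro conjI allI hopf_star_algebroid.\<epsilon>r_inv_S_star[OF assms]
    hopf_star_algebroid.\<epsilon>l_inv_S_star[OF assms] hopf_star_algebroid.S_star_S_star[OF assms]
    hopf_star_algebroid.star_base_action[OF assms])

end
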